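(* Suppose that, in a universe $\mathcal U$, path-induced equivalences are closed under homotopies (if $\operatorname{isPIE}(f)$ and $f\sim g$ then $\operatorname{isPIE}(g)$) and that for every $X:\mathcal U$ the diagonal map $\delta_X$ is a path-induced equivalence. Then for all $A,B:\mathcal U$ and all $f,g:A\to B$, $f\sim g\to f=g$.
   Context: Martin-Löf type theory with a universe $\mathcal U$ (no extensionality axioms assumed). For $f,g:A\to B$, $f\sim g:=\prod_{x:A}f(x)=g(x)$. $\operatorname{idtofun}:(A=B)\to(A\to B)$ is defined by path induction with $\operatorname{idtofun}(\mathrm{refl}_A)=\mathrm{id}_A$. For $f:A\to B$, $\operatorname{isPIE}_{A,B}(f):=\sum_{p:A=B}f=\operatorname{idtofun}(p)$; $f$ is a path-induced equivalence if this type is inhabited. The diagonal of $X$ is $\Delta X:=\sum_{a,a':X}a=a'$ and the diagonal map is $\delta_X:X\to\Delta X$, $\delta_X(x)=(x,x,\mathrm{refl}_x)$. *)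

theory Defs
  imports Main
begin

text \<open>
  Intensional Martin-Loef type theory with a cumulative hierarchy of Russell-style universes, in
  the presentation of the appendix of the HoTT book: dependent functions (with judgmental eta),
  dependent pairs, coproducts, empty type, unit type, natural numbers and identity types. There
  is no function extensionality, univalence, equality reflection or uniqueness of identity proofs.

  Terms are in de Bruijn form. The number of variables bound in an argument of an eliminator is
  the number of variables in the corresponding hypothesis: \<open>IndSig C g p\<close> is
  $\mathrm{ind}_\Sigma(z.C, x.y.g, p)$ and \<open>IndId C c a b p\<close> is
  $\mathrm{ind}_=(x.y.q.C, z.c, a, b, p)$; the variable bound last has index 0.
\<close>

datatype tm =
    Var nat
  | Univ nat
  | Pi tm tm
  | Lam tm tm
  | App tm tm
  | Sig tm tm
  | Pair tm tm
  | IndSig tm tm tm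
  | Plus tm tm
  | Inl tm
  | Inr tm
  | IndPlus tm tm tm tm
  | Empty
  | IndEmpty tm tm
  | Unit
  | Star
  | IndUnit tm tm tm
  | Nat
  | Zero
  | Succ tm
  | IndNat tm tm tm tm
  | Id tm tm tm
  | Refl tm
  | IndId tm tm tm tm tm

definition scons :: "'a \<Rightarrow> (nat \<Rightarrow> 'a) \<Rightarrow> nat \<Rightarrow> 'a"  (infixr \<open>\<cdot>\<close> 65) where
  "(x \<cdot> s) k = (case k of 0 \<Rightarrow> x | Suc j \<Rightarrow> s j)"

definition upr :: "(nat \<Rightarrow> nat) \<Rightarrow> nat \<Rightarrow> nat" where
  "upr r = 0 \<cdot> (\<lambda>k. Suc (r k))"

primrec ren :: "(nat \<Rightarrow> nat) \<Rightarrow> tm \<Rightarrow> tm" where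
  "ren r (Var k) = Var (r k)"
| "ren r (Univ n) = Univ n"
| "ren r (Pi A B) = Pi (ren r A) (ren (upr r) B)"
| "ren r (Lam A b) = Lam (ren r A) (ren (upr r) b)"
| "ren r (App f a) = App (ren r f) (ren r a)"
| "ren r (Sig A B) = Sig (ren r A) (ren (upr r) B)"
| "ren r (Pair a b) = Pair (ren r a) (ren r b)"
| "ren r (IndSig C g p) = IndSig (ren (upr r) C) (ren (upr (upr r)) g) (ren r p)"
| "ren r (Plus A B) = Plus (ren r A) (ren r B)"
| "ren r (Inl a) = Inl (ren r a)"
| "ren r (Inr b) = Inr (ren r b)"
| "ren r (IndPlus C c d e) = IndPlus (ren (upr r) C) (ren (upr r) c) (ren (upr r) d) (ren r e)"
| "ren r Empty = Empty"
| "ren r (IndEmpty C a) = IndEmpty (ren (upr r) C) (ren r a)"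
| "ren r Unit = Unit"
| "ren r Star = Star"
| "ren r (IndUnit C c a) = IndUnit (ren (upr r) C) (ren r c) (ren r a)"
| "ren r Nat = Nat"
| "ren r Zero = Zero"
| "ren r (Succ n) = Succ (ren r n)"
| "ren r (IndNat C c d n) = IndNat (ren (upr r) C) (ren r c) (ren (upr (upr r)) d) (ren r n)"
| "ren r (Id A a b) = Id (ren r A) (ren r a) (ren r b)"
| "ren r (Refl a) = Refl (ren r a)"
| "ren r (IndId C c a b p) =
     IndId (ren (upr (upr (upr r))) C) (ren (upr r) c) (ren r a) (ren r b) (ren r p)"

abbreviation lift :: "tm \<Rightarrow> tm"  (\<open>\<up>_\<close> [1000] 999) where
  "\<up>t \<equiv> ren Suc t"

definition ups :: "(nat \<Rightarrow> tm) \<Rightarrow> nat \<Rightarrow> tm" where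
  "ups s = Var 0 \<cdot> (\<lambda>k. \<up>(s k))"

primrec subst :: "(nat \<Rightarrow> tm) \<Rightarrow> tm \<Rightarrow> tm" where
  "subst s (Var k) = s k"
| "subst s (Univ n) = Univ n"
| "subst s (Pi A B) = Pi (subst s A) (subst (ups s) B)"
| "subst s (Lam A b) = Lam (subst s A) (subst (ups s) b)"
| "subst s (App f a) = App (subst s f) (subst s a)"
| "subst s (Sig A B) = Sig (subst s A) (subst (ups s) B)"
| "subst s (Pair a b) = Pair (subst s a) (subst s b)"
| "subst s (IndSig C g p) = IndSig (subst (ups s) C) (subst (ups (ups s)) g) (subst s p)"
| "subst s (Plus A B) = Plus (subst s A) (subst s B)"
| "subst s (Inl a) = Inl (subst s a)"
| "subst s (Inr b) = Inr (subst s b)"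
| "subst s (IndPlus C c d e) =
     IndPlus (subst (ups s) C) (subst (ups s) c) (subst (ups s) d) (subst s e)"
| "subst s Empty = Empty"
| "subst s (IndEmpty C a) = IndEmpty (subst (ups s) C) (subst s a)"
| "subst s Unit = Unit"
| "subst s Star = Star"
| "subst s (IndUnit C c a) = IndUnit (subst (ups s) C) (subst s c) (subst s a)"
| "subst s Nat = Nat"
| "subst s Zero = Zero"
| "subst s (Succ n) = Succ (subst s n)"
| "subst s (IndNat C c d n) =
     IndNat (subst (ups s) C) (subst s c) (subst (ups (ups s)) d) (subst s n)"
| "subst s (Id A a b) = Id (subst s A) (subst s a) (subst s b)"
| "subst s (Refl a) = Refl (subst s a)"
| "subst s (IndId C c a b p) =
     IndId (subst (ups (ups (ups s))) C) (subst (ups s) c) (subst s a) (subst s b) (subst s p)"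

abbreviation inst :: "tm \<Rightarrow> tm \<Rightarrow> tm"  (\<open>_\<lbrakk>_\<rbrakk>\<close> [1000, 0] 999) where
  "t\<lbrakk>a\<rbrakk> \<equiv> subst (a \<cdot> Var) t"

text \<open>
  A context lists the types of its variables, the most recent one first. In the premises of the
  elimination rules, a substitution such as \<open>Pair (Var 1) (Var 0) \<cdot> (\<lambda>k. Var (k + 2))\<close> replaces
  the variable of the motive by a constructor applied to the newly bound variables and weakens
  the motive by these variables.
\<close>

inductive
  wf_ctx :: "tm list \<Rightarrow> bool" and
  has_type :: "tm list \<Rightarrow> tm \<Rightarrow> tm \<Rightarrow> bool"  (\<open>_ \<turnstile> _ \<^bold>: _\<close> [51, 51, 51] 50) and
  jdg_eq :: "tm list \<Rightarrow> tm \<Rightarrow> tm \<Rightarrow> tm \<Rightarrow> bool"  (\<open>_ \<turnstile> _ \<doteq> _ \<^bold>: _\<close> [51, 51, 51, 51] 50)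
where
  ctx_emp: "wf_ctx []"
| ctx_ext: "\<Gamma> \<turnstile> A \<^bold>: Univ i \<Longrightarrow> wf_ctx (A # \<Gamma>)"

| vble: "\<lbrakk>wf_ctx \<Gamma>; k < length \<Gamma>\<rbrakk> \<Longrightarrow> \<Gamma> \<turnstile> Var k \<^bold>: ren (\<lambda>j. j + Suc k) (\<Gamma> ! k)"
| conv: "\<lbrakk>\<Gamma> \<turnstile> a \<^bold>: A; \<Gamma> \<turnstile> A \<doteq> B \<^bold>: Univ i\<rbrakk> \<Longrightarrow> \<Gamma> \<turnstile> a \<^bold>: B"

| eq_refl: "\<Gamma> \<turnstile> a \<^bold>: A \<Longrightarrow> \<Gamma> \<turnstile> a \<doteq> a \<^bold>: A"
| eq_sym: "\<Gamma> \<turnstile> a \<doteq> b \<^bold>: A \<Longrightarrow> \<Gamma> \<turnstile> b \<doteq> a \<^bold>: A"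
| eq_trans: "\<lbrakk>\<Gamma> \<turnstile> a \<doteq> b \<^bold>: A; \<Gamma> \<turnstile> b \<doteq> c \<^bold>: A\<rbrakk> \<Longrightarrow> \<Gamma> \<turnstile> a \<doteq> c \<^bold>: A"
| eq_conv: "\<lbrakk>\<Gamma> \<turnstile> a \<doteq> b \<^bold>: A; \<Gamma> \<turnstile> A \<doteq> B \<^bold>: Univ i\<rbrakk> \<Longrightarrow> \<Gamma> \<turnstile> a \<doteq> b \<^bold>: B"

| univ_intro: "wf_ctx \<Gamma> \<Longrightarrow> \<Gamma> \<turnstile> Univ i \<^bold>: Univ (Suc i)"
| univ_cumul: "\<Gamma> \<turnstile> A \<^bold>: Univ i \<Longrightarrow> \<Gamma> \<turnstile> A \<^bold>: Univ (Suc i)"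
| univ_cumul_eq: "\<Gamma> \<turnstile> A \<doteq> B \<^bold>: Univ i \<Longrightarrow> \<Gamma> \<turnstile> A \<doteq> B \<^bold>: Univ (Suc i)"

| Pi_form: "\<lbrakk>\<Gamma> \<turnstile> A \<^bold>: Univ i; A # \<Gamma> \<turnstile> B \<^bold>: Univ i\<rbrakk> \<Longrightarrow> \<Gamma> \<turnstile> Pi A B \<^bold>: Univ i"
| Pi_form_eq: "\<lbrakk>\<Gamma> \<turnstile> A \<doteq> A' \<^bold>: Univ i; A # \<Gamma> \<turnstile> B \<doteq> B' \<^bold>: Univ i\<rbrakk>
    \<Longrightarrow> \<Gamma> \<turnstile> Pi A B \<doteq> Pi A' B' \<^bold>: Univ i"
| Pi_intro: "A # \<Gamma> \<turnstile> b \<^bold>: B \<Longrightarrow> \<Gamma> \<turnstile> Lam A b \<^bold>: Pi A B"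
| Pi_intro_eq: "\<lbrakk>\<Gamma> \<turnstile> A \<doteq> A' \<^bold>: Univ i; A # \<Gamma> \<turnstile> b \<doteq> b' \<^bold>: B\<rbrakk>
    \<Longrightarrow> \<Gamma> \<turnstile> Lam A b \<doteq> Lam A' b' \<^bold>: Pi A B"
| Pi_elim: "\<lbrakk>\<Gamma> \<turnstile> f \<^bold>: Pi A B; \<Gamma> \<turnstile> a \<^bold>: A\<rbrakk> \<Longrightarrow> \<Gamma> \<turnstile> App f a \<^bold>: B\<lbrakk>a\<rbrakk>"
| Pi_elim_eq: "\<lbrakk>\<Gamma> \<turnstile> f \<doteq> f' \<^bold>: Pi A B; \<Gamma> \<turnstile> a \<doteq> a' \<^bold>: A\<rbrakk> \<Longrightarrow> \<Gamma> \<turnstile> App f a \<doteq> App f' a' \<^bold>: B\<lbrakk>a\<rbrakk>"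
| Pi_comp: "\<lbrakk>A # \<Gamma> \<turnstile> b \<^bold>: B; \<Gamma> \<turnstile> a \<^bold>: A\<rbrakk> \<Longrightarrow> \<Gamma> \<turnstile> App (Lam A b) a \<doteq> b\<lbrakk>a\<rbrakk> \<^bold>: B\<lbrakk>a\<rbrakk>"
| Pi_uniq: "\<Gamma> \<turnstile> f \<^bold>: Pi A B \<Longrightarrow> \<Gamma> \<turnstile> f \<doteq> Lam A (App (\<up>f) (Var 0)) \<^bold>: Pi A B"

| Sig_form: "\<lbrakk>\<Gamma> \<turnstile> A \<^bold>: Univ i; A # \<Gamma> \<turnstile> B \<^bold>: Univ i\<rbrakk> \<Longrightarrow> \<Gamma> \<turnstile> Sig A B \<^bold>: Univ i"
| Sig_form_eq: "\<lbrakk>\<Gamma> \<turnstile> A \<doteq> A' \<^bold>: Univ i; A # \<Gamma> \<turnstile> B \<doteq> B' \<^bold>: Univ i\<rbrakk>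
    \<Longrightarrow> \<Gamma> \<turnstile> Sig A B \<doteq> Sig A' B' \<^bold>: Univ i"
| Sig_intro: "\<lbrakk>A # \<Gamma> \<turnstile> B \<^bold>: Univ i; \<Gamma> \<turnstile> a \<^bold>: A; \<Gamma> \<turnstile> b \<^bold>: B\<lbrakk>a\<rbrakk>\<rbrakk> \<Longrightarrow> \<Gamma> \<turnstile> Pair a b \<^bold>: Sig A B"
| Sig_intro_eq: "\<lbrakk>A # \<Gamma> \<turnstile> B \<^bold>: Univ i; \<Gamma> \<turnstile> a \<doteq> a' \<^bold>: A; \<Gamma> \<turnstile> b \<doteq> b' \<^bold>: B\<lbrakk>a\<rbrakk>\<rbrakk>
    \<Longrightarrow> \<Gamma> \<turnstile> Pair a b \<doteq> Pair a' b' \<^bold>: Sig A B"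
| Sig_elim: "\<lbrakk>Sig A B # \<Gamma> \<turnstile> C \<^bold>: Univ i;
      B # A # \<Gamma> \<turnstile> g \<^bold>: subst (Pair (Var 1) (Var 0) \<cdot> (\<lambda>k. Var (k + 2))) C;
      \<Gamma> \<turnstile> p \<^bold>: Sig A B\<rbrakk>
    \<Longrightarrow> \<Gamma> \<turnstile> IndSig C g p \<^bold>: C\<lbrakk>p\<rbrakk>"
| Sig_elim_eq: "\<lbrakk>Sig A B # \<Gamma> \<turnstile> C \<doteq> C' \<^bold>: Univ i;
      B # A # \<Gamma> \<turnstile> g \<doteq> g' \<^bold>: subst (Pair (Var 1) (Var 0) \<cdot> (\<lambda>k. Var (k + 2))) C;
      \<Gamma> \<turnstile> p \<doteq> p' \<^bold>: Sig A B\<rbrakk>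
    \<Longrightarrow> \<Gamma> \<turnstile> IndSig C g p \<doteq> IndSig C' g' p' \<^bold>: C\<lbrakk>p\<rbrakk>"
| Sig_comp: "\<lbrakk>Sig A B # \<Gamma> \<turnstile> C \<^bold>: Univ i;
      B # A # \<Gamma> \<turnstile> g \<^bold>: subst (Pair (Var 1) (Var 0) \<cdot> (\<lambda>k. Var (k + 2))) C;
      \<Gamma> \<turnstile> a \<^bold>: A; \<Gamma> \<turnstile> b \<^bold>: B\<lbrakk>a\<rbrakk>\<rbrakk>
    \<Longrightarrow> \<Gamma> \<turnstile> IndSig C g (Pair a b) \<doteq> subst (b \<cdot> a \<cdot> Var) g \<^bold>: C\<lbrakk>Pair a b\<rbrakk>"

| Plus_form: "\<lbrakk>\<Gamma> \<turnstile> A \<^bold>: Univ i; \<Gamma> \<turnstile> B \<^bold>: Univ i\<rbrakk> \<Longrightarrow> \<Gamma> \<turnstile> Plus A B \<^bold>: Univ i"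
| Plus_form_eq: "\<lbrakk>\<Gamma> \<turnstile> A \<doteq> A' \<^bold>: Univ i; \<Gamma> \<turnstile> B \<doteq> B' \<^bold>: Univ i\<rbrakk>
    \<Longrightarrow> \<Gamma> \<turnstile> Plus A B \<doteq> Plus A' B' \<^bold>: Univ i"
| Plus_intro1: "\<lbrakk>\<Gamma> \<turnstile> A \<^bold>: Univ i; \<Gamma> \<turnstile> B \<^bold>: Univ i; \<Gamma> \<turnstile> a \<^bold>: A\<rbrakk> \<Longrightarrow> \<Gamma> \<turnstile> Inl a \<^bold>: Plus A B"
| Plus_intro2: "\<lbrakk>\<Gamma> \<turnstile> A \<^bold>: Univ i; \<Gamma> \<turnstile> B \<^bold>: Univ i; \<Gamma> \<turnstile> b \<^bold>: B\<rbrakk> \<Longrightarrow> \<Gamma> \<turnstile> Inr b \<^bold>: Plus A B"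
| Plus_intro1_eq: "\<lbrakk>\<Gamma> \<turnstile> A \<^bold>: Univ i; \<Gamma> \<turnstile> B \<^bold>: Univ i; \<Gamma> \<turnstile> a \<doteq> a' \<^bold>: A\<rbrakk>
    \<Longrightarrow> \<Gamma> \<turnstile> Inl a \<doteq> Inl a' \<^bold>: Plus A B"
| Plus_intro2_eq: "\<lbrakk>\<Gamma> \<turnstile> A \<^bold>: Univ i; \<Gamma> \<turnstile> B \<^bold>: Univ i; \<Gamma> \<turnstile> b \<doteq> b' \<^bold>: B\<rbrakk>
    \<Longrightarrow> \<Gamma> \<turnstile> Inr b \<doteq> Inr b' \<^bold>: Plus A B"
| Plus_elim: "\<lbrakk>Plus A B # \<Gamma> \<turnstile> C \<^bold>: Univ i;
      A # \<Gamma> \<turnstile> c \<^bold>: subst (Inl (Var 0) \<cdot> (\<lambda>k. Var (k + 1))) C;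
      B # \<Gamma> \<turnstile> d \<^bold>: subst (Inr (Var 0) \<cdot> (\<lambda>k. Var (k + 1))) C;
      \<Gamma> \<turnstile> e \<^bold>: Plus A B\<rbrakk>
    \<Longrightarrow> \<Gamma> \<turnstile> IndPlus C c d e \<^bold>: C\<lbrakk>e\<rbrakk>"
| Plus_elim_eq: "\<lbrakk>Plus A B # \<Gamma> \<turnstile> C \<doteq> C' \<^bold>: Univ i;
      A # \<Gamma> \<turnstile> c \<doteq> c' \<^bold>: subst (Inl (Var 0) \<cdot> (\<lambda>k. Var (k + 1))) C;
      B # \<Gamma> \<turnstile> d \<doteq> d' \<^bold>: subst (Inr (Var 0) \<cdot> (\<lambda>k. Var (k + 1))) C;
      \<Gamma> \<turnstile> e \<doteq> e' \<^bold>: Plus A B\<rbrakk>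
    \<Longrightarrow> \<Gamma> \<turnstile> IndPlus C c d e \<doteq> IndPlus C' c' d' e' \<^bold>: C\<lbrakk>e\<rbrakk>"
| Plus_comp1: "\<lbrakk>Plus A B # \<Gamma> \<turnstile> C \<^bold>: Univ i;
      A # \<Gamma> \<turnstile> c \<^bold>: subst (Inl (Var 0) \<cdot> (\<lambda>k. Var (k + 1))) C;
      B # \<Gamma> \<turnstile> d \<^bold>: subst (Inr (Var 0) \<cdot> (\<lambda>k. Var (k + 1))) C;
      \<Gamma> \<turnstile> a \<^bold>: A\<rbrakk>
    \<Longrightarrow> \<Gamma> \<turnstile> IndPlus C c d (Inl a) \<doteq> c\<lbrakk>a\<rbrakk> \<^bold>: C\<lbrakk>Inl a\<rbrakk>"
| Plus_comp2: "\<lbrakk>Plus A B # \<Gamma> \<turnstile> C \<^bold>: Univ i;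
      A # \<Gamma> \<turnstile> c \<^bold>: subst (Inl (Var 0) \<cdot> (\<lambda>k. Var (k + 1))) C;
      B # \<Gamma> \<turnstile> d \<^bold>: subst (Inr (Var 0) \<cdot> (\<lambda>k. Var (k + 1))) C;
      \<Gamma> \<turnstile> b \<^bold>: B\<rbrakk>
    \<Longrightarrow> \<Gamma> \<turnstile> IndPlus C c d (Inr b) \<doteq> d\<lbrakk>b\<rbrakk> \<^bold>: C\<lbrakk>Inr b\<rbrakk>"

| Empty_form: "wf_ctx \<Gamma> \<Longrightarrow> \<Gamma> \<turnstile> Empty \<^bold>: Univ i"
| Empty_elim: "\<lbrakk>Empty # \<Gamma> \<turnstile> C \<^bold>: Univ i; \<Gamma> \<turnstile> a \<^bold>: Empty\<rbrakk> \<Longrightarrow> \<Gamma> \<turnstile> IndEmpty C a \<^bold>: C\<lbrakk>a\<rbrakk>"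
| Empty_elim_eq: "\<lbrakk>Empty # \<Gamma> \<turnstile> C \<doteq> C' \<^bold>: Univ i; \<Gamma> \<turnstile> a \<doteq> a' \<^bold>: Empty\<rbrakk>
    \<Longrightarrow> \<Gamma> \<turnstile> IndEmpty C a \<doteq> IndEmpty C' a' \<^bold>: C\<lbrakk>a\<rbrakk>"

| Unit_form: "wf_ctx \<Gamma> \<Longrightarrow> \<Gamma> \<turnstile> Unit \<^bold>: Univ i"
| Unit_intro: "wf_ctx \<Gamma> \<Longrightarrow> \<Gamma> \<turnstile> Star \<^bold>: Unit"
| Unit_elim: "\<lbrakk>Unit # \<Gamma> \<turnstile> C \<^bold>: Univ i; \<Gamma> \<turnstile> c \<^bold>: C\<lbrakk>Star\<rbrakk>; \<Gamma> \<turnstile> a \<^bold>: Unit\<rbrakk>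
    \<Longrightarrow> \<Gamma> \<turnstile> IndUnit C c a \<^bold>: C\<lbrakk>a\<rbrakk>"
| Unit_elim_eq: "\<lbrakk>Unit # \<Gamma> \<turnstile> C \<doteq> C' \<^bold>: Univ i; \<Gamma> \<turnstile> c \<doteq> c' \<^bold>: C\<lbrakk>Star\<rbrakk>; \<Gamma> \<turnstile> a \<doteq> a' \<^bold>: Unit\<rbrakk>
    \<Longrightarrow> \<Gamma> \<turnstile> IndUnit C c a \<doteq> IndUnit C' c' a' \<^bold>: C\<lbrakk>a\<rbrakk>"
| Unit_comp: "\<lbrakk>Unit # \<Gamma> \<turnstile> C \<^bold>: Univ i; \<Gamma> \<turnstile> c \<^bold>: C\<lbrakk>Star\<rbrakk>\<rbrakk>
    \<Longrightarrow> \<Gamma> \<turnstile> IndUnit C c Star \<doteq> c \<^bold>: C\<lbrakk>Star\<rbrakk>"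

| Nat_form: "wf_ctx \<Gamma> \<Longrightarrow> \<Gamma> \<turnstile> Nat \<^bold>: Univ i"
| Nat_intro1: "wf_ctx \<Gamma> \<Longrightarrow> \<Gamma> \<turnstile> Zero \<^bold>: Nat"
| Nat_intro2: "\<Gamma> \<turnstile> n \<^bold>: Nat \<Longrightarrow> \<Gamma> \<turnstile> Succ n \<^bold>: Nat"
| Nat_intro2_eq: "\<Gamma> \<turnstile> n \<doteq> n' \<^bold>: Nat \<Longrightarrow> \<Gamma> \<turnstile> Succ n \<doteq> Succ n' \<^bold>: Nat"
| Nat_elim: "\<lbrakk>Nat # \<Gamma> \<turnstile> C \<^bold>: Univ i; \<Gamma> \<turnstile> c \<^bold>: C\<lbrakk>Zero\<rbrakk>;
      C # Nat # \<Gamma> \<turnstile> d \<^bold>: subst (Succ (Var 1) \<cdot> (\<lambda>k. Var (k + 2))) C;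
      \<Gamma> \<turnstile> n \<^bold>: Nat\<rbrakk>
    \<Longrightarrow> \<Gamma> \<turnstile> IndNat C c d n \<^bold>: C\<lbrakk>n\<rbrakk>"
| Nat_elim_eq: "\<lbrakk>Nat # \<Gamma> \<turnstile> C \<doteq> C' \<^bold>: Univ i; \<Gamma> \<turnstile> c \<doteq> c' \<^bold>: C\<lbrakk>Zero\<rbrakk>;
      C # Nat # \<Gamma> \<turnstile> d \<doteq> d' \<^bold>: subst (Succ (Var 1) \<cdot> (\<lambda>k. Var (k + 2))) C;
      \<Gamma> \<turnstile> n \<doteq> n' \<^bold>: Nat\<rbrakk>
    \<Longrightarrow> \<Gamma> \<turnstile> IndNat C c d n \<doteq> IndNat C' c' d' n' \<^bold>: C\<lbrakk>n\<rbrakk>"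
| Nat_comp1: "\<lbrakk>Nat # \<Gamma> \<turnstile> C \<^bold>: Univ i; \<Gamma> \<turnstile> c \<^bold>: C\<lbrakk>Zero\<rbrakk>;
      C # Nat # \<Gamma> \<turnstile> d \<^bold>: subst (Succ (Var 1) \<cdot> (\<lambda>k. Var (k + 2))) C\<rbrakk>
    \<Longrightarrow> \<Gamma> \<turnstile> IndNat C c d Zero \<doteq> c \<^bold>: C\<lbrakk>Zero\<rbrakk>"
| Nat_comp2: "\<lbrakk>Nat # \<Gamma> \<turnstile> C \<^bold>: Univ i; \<Gamma> \<turnstile> c \<^bold>: C\<lbrakk>Zero\<rbrakk>;
      C # Nat # \<Gamma> \<turnstile> d \<^bold>: subst (Succ (Var 1) \<cdot> (\<lambda>k. Var (k + 2))) C;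
      \<Gamma> \<turnstile> n \<^bold>: Nat\<rbrakk>
    \<Longrightarrow> \<Gamma> \<turnstile> IndNat C c d (Succ n) \<doteq> subst (IndNat C c d n \<cdot> n \<cdot> Var) d \<^bold>: C\<lbrakk>Succ n\<rbrakk>"

| Id_form: "\<lbrakk>\<Gamma> \<turnstile> A \<^bold>: Univ i; \<Gamma> \<turnstile> a \<^bold>: A; \<Gamma> \<turnstile> b \<^bold>: A\<rbrakk> \<Longrightarrow> \<Gamma> \<turnstile> Id A a b \<^bold>: Univ i"
| Id_form_eq: "\<lbrakk>\<Gamma> \<turnstile> A \<doteq> A' \<^bold>: Univ i; \<Gamma> \<turnstile> a \<doteq> a' \<^bold>: A; \<Gamma> \<turnstile> b \<doteq> b' \<^bold>: A\<rbrakk>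
    \<Longrightarrow> \<Gamma> \<turnstile> Id A a b \<doteq> Id A' a' b' \<^bold>: Univ i"
| Id_intro: "\<lbrakk>\<Gamma> \<turnstile> A \<^bold>: Univ i; \<Gamma> \<turnstile> a \<^bold>: A\<rbrakk> \<Longrightarrow> \<Gamma> \<turnstile> Refl a \<^bold>: Id A a a"
| Id_intro_eq: "\<lbrakk>\<Gamma> \<turnstile> A \<^bold>: Univ i; \<Gamma> \<turnstile> a \<doteq> a' \<^bold>: A\<rbrakk> \<Longrightarrow> \<Gamma> \<turnstile> Refl a \<doteq> Refl a' \<^bold>: Id A a a"
| Id_elim: "\<lbrakk>Id (\<up>(\<up>A)) (Var 1) (Var 0) # \<up>A # A # \<Gamma> \<turnstile> C \<^bold>: Univ i;
      A # \<Gamma> \<turnstile> c \<^bold>: subst (Refl (Var 0) \<cdot> Var 0 \<cdot> Var 0 \<cdot> (\<lambda>k. Var (k + 1))) C;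
      \<Gamma> \<turnstile> a \<^bold>: A; \<Gamma> \<turnstile> b \<^bold>: A; \<Gamma> \<turnstile> p \<^bold>: Id A a b\<rbrakk>
    \<Longrightarrow> \<Gamma> \<turnstile> IndId C c a b p \<^bold>: subst (p \<cdot> b \<cdot> a \<cdot> Var) C"
| Id_elim_eq: "\<lbrakk>Id (\<up>(\<up>A)) (Var 1) (Var 0) # \<up>A # A # \<Gamma> \<turnstile> C \<doteq> C' \<^bold>: Univ i;
      A # \<Gamma> \<turnstile> c \<doteq> c' \<^bold>: subst (Refl (Var 0) \<cdot> Var 0 \<cdot> Var 0 \<cdot> (\<lambda>k. Var (k + 1))) C;
      \<Gamma> \<turnstile> a \<doteq> a' \<^bold>: A; \<Gamma> \<turnstile> b \<doteq> b' \<^bold>: A; \<Gamma> \<turnstile> p \<doteq> p' \<^bold>: Id A a b\<rbrakk>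
    \<Longrightarrow> \<Gamma> \<turnstile> IndId C c a b p \<doteq> IndId C' c' a' b' p' \<^bold>: subst (p \<cdot> b \<cdot> a \<cdot> Var) C"
| Id_comp: "\<lbrakk>Id (\<up>(\<up>A)) (Var 1) (Var 0) # \<up>A # A # \<Gamma> \<turnstile> C \<^bold>: Univ i;
      A # \<Gamma> \<turnstile> c \<^bold>: subst (Refl (Var 0) \<cdot> Var 0 \<cdot> Var 0 \<cdot> (\<lambda>k. Var (k + 1))) C;
      \<Gamma> \<turnstile> a \<^bold>: A\<rbrakk>
    \<Longrightarrow> \<Gamma> \<turnstile> IndId C c a a (Refl a) \<doteq> c\<lbrakk>a\<rbrakk> \<^bold>: subst (Refl a \<cdot> a \<cdot> a \<cdot> Var) C"

definition inhabited :: "tm \<Rightarrow> bool" where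
  "inhabited A \<longleftrightarrow> (\<exists>t. [] \<turnstile> t \<^bold>: A)"

definition Arr :: "tm \<Rightarrow> tm \<Rightarrow> tm"  (infixr \<open>\<rightarrow>\<^sub>t\<close> 60) where
  "A \<rightarrow>\<^sub>t B = Pi A (\<up>B)"

definition Homotopy :: "tm \<Rightarrow> tm \<Rightarrow> tm \<Rightarrow> tm \<Rightarrow> tm" where
  "Homotopy A B f g = Pi A (Id (\<up>B) (App (\<up>f) (Var 0)) (App (\<up>g) (Var 0)))"

text \<open>
  \<open>idtofun i A B\<close> is the function $(A =_{\mathcal U_i} B) \to (A \to B)$ given by path induction with
  motive $X, Y, q \mapsto (X \to Y)$ and with $\mathrm{id}_Z$ over $\mathrm{refl}_Z$.
\<close>

definition idtofun :: "nat \<Rightarrow> tm \<Rightarrow> tm \<Rightarrow> tm" where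
  "idtofun i A B =
     Lam (Id (Univ i) A B)
       (IndId (Var 2 \<rightarrow>\<^sub>t Var 1) (Lam (Var 0) (Var 0)) (\<up>A) (\<up>B) (Var 0))"

definition isPIE :: "nat \<Rightarrow> tm \<Rightarrow> tm \<Rightarrow> tm \<Rightarrow> tm" where
  "isPIE i A B f =
     Sig (Id (Univ i) A B)
       (Id (\<up>(A \<rightarrow>\<^sub>t B)) (\<up>f) (App (\<up>(idtofun i A B)) (Var 0)))"

definition Diag :: "tm \<Rightarrow> tm" where
  "Diag X = Sig X (Sig (\<up>X) (Id (\<up>(\<up>X)) (Var 1) (Var 0)))"

definition diag_map :: "tm \<Rightarrow> tm" where
  "diag_map X = Lam X (Pair (Var 0) (Pair (Var 0) (Refl (Var 0))))"

text \<open>In the two types below, the variables $A, B, f, g$ have indices 3, 2, 1, 0 in the body.\<close>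

definition PIE_closed_under_homotopies :: "nat \<Rightarrow> tm" where
  "PIE_closed_under_homotopies i =
     Pi (Univ i) (Pi (Univ i) (Pi (Var 1 \<rightarrow>\<^sub>t Var 0) (Pi (Var 2 \<rightarrow>\<^sub>t Var 1)
       (isPIE i (Var 3) (Var 2) (Var 1) \<rightarrow>\<^sub>t
        Homotopy (Var 3) (Var 2) (Var 1) (Var 0) \<rightarrow>\<^sub>t
        isPIE i (Var 3) (Var 2) (Var 0)))))"

definition homotopic_imp_eq :: "nat \<Rightarrow> tm" where
  "homotopic_imp_eq i =
     Pi (Univ i) (Pi (Univ i) (Pi (Var 1 \<rightarrow>\<^sub>t Var 0) (Pi (Var 2 \<rightarrow>\<^sub>t Var 1)
       (Homotopy (Var 3) (Var 2) (Var 1) (Var 0) \<rightarrow>\<^sub>t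
        Id (Var 3 \<rightarrow>\<^sub>t Var 2) (Var 1) (Var 0)))))"

definition diag_maps_PIE :: "nat \<Rightarrow> tm" where
  "diag_maps_PIE i = Pi (Univ i) (isPIE i (Var 0) (Diag (Var 0)) (diag_map (Var 0)))"

end

theory Submission
  imports Defs
begin

text \<open>
  Let $\pi_1, \pi_2 : \Delta B \to B$ be the endpoint projections. Since $\pi_1 \circ \delta_B$
  and $\pi_2 \circ \delta_B$ are both judgmentally the identity and $\delta_B =
  \mathrm{idtofun}(p)$ for some $p$, the equation $\pi_1 = \pi_2$ follows once precomposition with
  $\mathrm{idtofun}(p)$ is injective; by path induction this reduces to $p = \mathrm{refl}$, where
  precomposition is judgmentally the identity by eta. A homotopy $h : f \sim g$ yields
  $k(a) = (f(a), g(a), h(a))$ with $f \equiv \pi_1 \circ k$ and $g \equiv \pi_2 \circ k$, whence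
  $f = g$.
\<close>

section \<open>Renaming and substitution\<close>

lemma scons_simps [simp]: "(x \<cdot> s) 0 = x" "(x \<cdot> s) (Suc k) = s k"
  by (simp_all add: scons_def)

lemma upr_simps [simp]: "upr r 0 = 0" "upr r (Suc k) = Suc (r k)"
  by (simp_all add: upr_def)

lemma ups_simps [simp]: "ups s 0 = Var 0" "ups s (Suc k) = \<up>(s k)"
  by (simp_all add: ups_def)

lemma upr_comp: "upr (r \<circ> r') = upr r \<circ> upr r'"
proof
  show "upr (r \<circ> r') k = (upr r \<circ> upr r') k" for k by (cases k) simp_all
qed

lemma ren_ren: "ren r (ren r' t) = ren (r \<circ> r') t"
  by (induction t arbitrary: r r') (simp_all add: upr_comp)

lemma ups_comp_upr: "ups (s \<circ> r) = ups s \<circ> upr r"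
proof
  show "ups (s \<circ> r) k = (ups s \<circ> upr r) k" for k by (cases k) simp_all
qed

lemma subst_ren: "subst s (ren r t) = subst (s \<circ> r) t"
  by (induction t arbitrary: s r) (simp_all add: ups_comp_upr)

lemma ren_upr_lift [simp]: "ren (upr r) (\<up>t) = \<up>(ren r t)"
  by (simp add: ren_ren comp_def)

lemma ups_ren: "ups (ren r \<circ> s) = ren (upr r) \<circ> ups s"
proof
  show "ups (ren r \<circ> s) k = (ren (upr r) \<circ> ups s) k" for k by (cases k) simp_all
qed

lemma ren_subst: "ren r (subst s t) = subst (ren r \<circ> s) t"
  by (induction t arbitrary: r s) (simp_all add: ups_ren)

lemma ups_Var [simp]: "ups Var = Var"
proof
  show "ups Var k = Var k" for k by (cases k) simp_all
qed

lemma subst_Var [simp]: "subst Var t = t"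
  by (induction t) simp_all

lemma subst_ups_lift [simp]: "subst (ups s) (\<up>t) = \<up>(subst s t)"
  by (simp add: subst_ren ren_subst comp_def)

lemma subst_scons_lift [simp]: "subst (x \<cdot> s) (\<up>t) = subst s t"
  by (simp add: subst_ren comp_def)

text \<open>Weakening below a binder and then filling the bound variable with \<open>Var 0\<close>
  is the identity substitution. This is what remains after beta-reducing a weakened abstraction
  applied to \<open>Var 0\<close>.\<close>

lemma subst_scons_ren_upr_Suc [simp]: "subst (Var 0 \<cdot> Var) (ren (upr Suc) t) = t"
proof -
  have "(Var 0 \<cdot> Var) \<circ> upr Suc = Var"
  proof
    show "((Var 0 \<cdot> Var) \<circ> upr Suc) k = Var k" for k by (cases k) simp_all
  qed
  then show ?thesis by (simp add: subst_ren)
qed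

section \<open>Stability of the derived types and maps under renaming and substitution\<close>

lemma ren_idtofun [simp]: "ren r (idtofun i X Y) = idtofun i (ren r X) (ren r Y)"
  by (simp add: idtofun_def Arr_def numeral_eq_Suc)

lemma subst_idtofun [simp]: "subst s (idtofun i X Y) = idtofun i (subst s X) (subst s Y)"
  by (simp add: idtofun_def Arr_def numeral_eq_Suc)

lemma ren_isPIE [simp]: "ren r (isPIE i X Y f) = isPIE i (ren r X) (ren r Y) (ren r f)"
  by (simp add: isPIE_def Arr_def)

lemma subst_isPIE [simp]: "subst s (isPIE i X Y f) = isPIE i (subst s X) (subst s Y) (subst s f)"
  by (simp add: isPIE_def Arr_def)

lemma ren_Diag [simp]: "ren r (Diag X) = Diag (ren r X)"
  by (simp add: Diag_def)

lemma subst_Diag [simp]: "subst s (Diag X) = Diag (subst s X)"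
  by (simp add: Diag_def)

lemma ren_diag_map [simp]: "ren r (diag_map X) = diag_map (ren r X)"
  by (simp add: diag_map_def)

lemma subst_diag_map [simp]: "subst s (diag_map X) = diag_map (subst s X)"
  by (simp add: diag_map_def)

text \<open>The type is closed. Hence the lifts inserted by \<open>Arr\<close> vanish, and a
  hypothesis of this type keeps it when read off from any depth of the context.\<close>

lemma ren_diag_maps_PIE [simp]: "ren r (diag_maps_PIE i) = diag_maps_PIE i"
  by (simp add: diag_maps_PIE_def)

lemma ren_homotopic_imp_eq [simp]: "ren r (homotopic_imp_eq i) = homotopic_imp_eq i"
  by (simp add: homotopic_imp_eq_def Arr_def Homotopy_def numeral_eq_Suc)

section \<open>Bidirectional type checking\<close>

text \<open>
  Relativising the judgments to well-formed contexts gives rules in which the binder cases carry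
  well-formedness along, so that it need not be rederived at each variable. Read as conditional
  rewrite rules they let the simplifier check concrete terms. There is no weakening lemma: the
  rules ask for the weakened types explicitly, and the constructions below are closed terms that
  check in every context.
\<close>

definition checks :: "tm list \<Rightarrow> tm \<Rightarrow> tm \<Rightarrow> bool" where
  "checks \<Gamma> t T \<longleftrightarrow> (wf_ctx \<Gamma> \<longrightarrow> \<Gamma> \<turnstile> t \<^bold>: T)"

definition equates :: "tm list \<Rightarrow> tm \<Rightarrow> tm \<Rightarrow> tm \<Rightarrow> bool" where
  "equates \<Gamma> a b T \<longleftrightarrow> (wf_ctx \<Gamma> \<longrightarrow> \<Gamma> \<turnstile> a \<doteq> b \<^bold>: T)"

lemma checks_Var: "\<lbrakk>k < length \<Gamma>; ren (\<lambda>j. j + Suc k) (\<Gamma> ! k) = T\<rbrakk> \<Longrightarrow> checks \<Gamma> (Var k) T"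
  using vble[of \<Gamma> k] by (auto simp: checks_def)

text \<open>Quantifying over \<open>Univ i\<close> raises formation goals to level
  \<open>Suc i\<close>, while the types quantified over are variables in \<open>Univ i\<close>.
  Applying cumulativity at variables only keeps checking directed by syntax.\<close>

lemma checks_Var_cumul: "\<lbrakk>k < length \<Gamma>; \<Gamma> ! k = Univ i\<rbrakk> \<Longrightarrow> checks \<Gamma> (Var k) (Univ (Suc i))"
  using vble[of \<Gamma> k] by (auto simp: checks_def intro: univ_cumul)

lemma checks_Univ: "checks \<Gamma> (Univ i) (Univ (Suc i))"
  by (auto simp: checks_def intro: univ_intro)

lemma checks_Pi: "\<lbrakk>checks \<Gamma> A (Univ i); checks (A # \<Gamma>) B (Univ i)\<rbrakk> \<Longrightarrow> checks \<Gamma> (Pi A B) (Univ i)"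
  by (auto simp: checks_def intro: Pi_form ctx_ext)

lemma checks_Sig: "\<lbrakk>checks \<Gamma> A (Univ i); checks (A # \<Gamma>) B (Univ i)\<rbrakk> \<Longrightarrow> checks \<Gamma> (Sig A B) (Univ i)"
  by (auto simp: checks_def intro: Sig_form ctx_ext)

lemma checks_Id:
  "\<lbrakk>checks \<Gamma> A (Univ i); checks \<Gamma> a A; checks \<Gamma> b A\<rbrakk> \<Longrightarrow> checks \<Gamma> (Id A a b) (Univ i)"
  by (auto simp: checks_def intro: Id_form)

lemma checks_Lam:
  "\<lbrakk>checks \<Gamma> A (Univ i); checks (A # \<Gamma>) b B\<rbrakk> \<Longrightarrow> checks \<Gamma> (Lam A b) (Pi A B)"
  by (auto simp: checks_def intro: Pi_intro ctx_ext)

lemma checks_App: "\<lbrakk>checks \<Gamma> f (Pi A B); checks \<Gamma> a A; B\<lbrakk>a\<rbrakk> = T\<rbrakk> \<Longrightarrow> checks \<Gamma> (App f a) T"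
  by (auto simp: checks_def intro: Pi_elim)

text \<open>The conclusion of \<open>checks_App\<close> does not determine \<open>A\<close> and
  \<open>B\<close>. For a variable head they are read off from the context, which makes the rule
  usable for rewriting.\<close>

lemma checks_App_Var:
  assumes "k < length \<Gamma>"
    and "case ren (\<lambda>j. j + Suc k) (\<Gamma> ! k) of Pi A B \<Rightarrow> checks \<Gamma> a A \<and> B\<lbrakk>a\<rbrakk> = T | _ \<Rightarrow> False"
  shows "checks \<Gamma> (App (Var k) a) T"
  using assms checks_Var[OF assms(1) refl] by (auto split: tm.splits intro: checks_App)

text \<open>A separate constant for iterated application lets \<open>checks_Apps\<close> recognise a
  closed head term whose type is already known; for this its equations are later removed from the
  simplifier.\<close>

primrec Apps :: "tm \<Rightarrow> tm list \<Rightarrow> tm" where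
  "Apps f [] = f"
| "Apps f (a # as) = Apps (App f a) as"

text \<open>Starts from the type of the head and instantiates the codomain with one argument at a
  time, so that a whole application is checked by computation.\<close>

fun spine_type :: "tm list \<Rightarrow> tm \<Rightarrow> tm list \<Rightarrow> tm \<Rightarrow> bool" where
  "spine_type \<Gamma> T [] T' \<longleftrightarrow> T = T'"
| "spine_type \<Gamma> (Pi A B) (a # as) T' \<longleftrightarrow> checks \<Gamma> a A \<and> spine_type \<Gamma> (B\<lbrakk>a\<rbrakk>) as T'"
| "spine_type \<Gamma> _ (a # as) T' \<longleftrightarrow> False"

lemma checks_Apps:
  "\<lbrakk>checks \<Gamma> f T; spine_type \<Gamma> T as T'\<rbrakk> \<Longrightarrow> checks \<Gamma> (Apps f as) T'"
  by (induction \<Gamma> T as T' arbitrary: f rule: spine_type.induct) (auto intro: checks_App)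

lemma checks_Pair:
  "\<lbrakk>checks \<Gamma> A (Univ i); checks (A # \<Gamma>) B (Univ i); checks \<Gamma> a A; checks \<Gamma> b (B\<lbrakk>a\<rbrakk>)\<rbrakk>
    \<Longrightarrow> checks \<Gamma> (Pair a b) (Sig A B)"
  by (auto simp: checks_def intro: Sig_intro ctx_ext)

lemma checks_IndSig:
  assumes "checks \<Gamma> A (Univ i)" "checks (A # \<Gamma>) B (Univ i)" "checks (Sig A B # \<Gamma>) C (Univ i)"
    and "checks (B # A # \<Gamma>) g (subst (Pair (Var 1) (Var 0) \<cdot> (\<lambda>k. Var (k + 2))) C)"
    and "checks \<Gamma> p (Sig A B)" "C\<lbrakk>p\<rbrakk> = T"
  shows "checks \<Gamma> (IndSig C g p) T"
  using assms by (fastforce simp: checks_def intro: Sig_elim ctx_ext Sig_form)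

lemma checks_Refl:
  "\<lbrakk>checks \<Gamma> A (Univ i); checks \<Gamma> a A\<rbrakk> \<Longrightarrow> checks \<Gamma> (Refl a) (Id A a a)"
  by (auto simp: checks_def intro: Id_intro)

lemma checks_IndId:
  assumes "checks \<Gamma> A (Univ i)" "checks (A # \<Gamma>) (\<up>A) (Univ i)"
    and "checks (\<up>A # A # \<Gamma>) (\<up>(\<up>A)) (Univ i)"
    and "checks (Id (\<up>(\<up>A)) (Var 1) (Var 0) # \<up>A # A # \<Gamma>) C (Univ i)"
    and "checks (A # \<Gamma>) c (subst (Refl (Var 0) \<cdot> Var 0 \<cdot> Var 0 \<cdot> (\<lambda>k. Var (k + 1))) C)"
    and "checks \<Gamma> a A" "checks \<Gamma> b A" "checks \<Gamma> p (Id A a b)"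
    and "subst (p \<cdot> b \<cdot> a \<cdot> Var) C = T"
  shows "checks \<Gamma> (IndId C c a b p) T"
proof -
  have "checks (\<up>A # A # \<Gamma>) (Id (\<up>(\<up>A)) (Var 1) (Var 0)) (Univ i)"
    using assms(3) by (intro checks_Id checks_Var) (simp_all add: ren_ren comp_def)
  then show ?thesis
    using assms by (auto simp: checks_def intro!: Id_elim intro: ctx_ext)
qed

lemma checks_conv: "\<lbrakk>checks \<Gamma> a A; equates \<Gamma> A B (Univ i)\<rbrakk> \<Longrightarrow> checks \<Gamma> a B"
  by (auto simp: checks_def equates_def intro: conv)


section \<open>Rules for judgmental equality\<close>

lemma equates_refl: "checks \<Gamma> a A \<Longrightarrow> equates \<Gamma> a a A"
  by (auto simp: checks_def equates_def intro: eq_refl)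

lemma equates_sym: "equates \<Gamma> a b A \<Longrightarrow> equates \<Gamma> b a A"
  by (auto simp: equates_def intro: eq_sym)

lemma equates_trans: "\<lbrakk>equates \<Gamma> a b A; equates \<Gamma> b c A\<rbrakk> \<Longrightarrow> equates \<Gamma> a c A"
  by (auto simp: equates_def intro: eq_trans)

lemma equates_Id:
  "\<lbrakk>checks \<Gamma> A (Univ i); equates \<Gamma> a a' A; equates \<Gamma> b b' A\<rbrakk>
    \<Longrightarrow> equates \<Gamma> (Id A a b) (Id A a' b') (Univ i)"
  by (auto simp: checks_def equates_def intro: Id_form_eq eq_refl)

lemma equates_Lam:
  "\<lbrakk>checks \<Gamma> A (Univ i); equates (A # \<Gamma>) b b' B\<rbrakk> \<Longrightarrow> equates \<Gamma> (Lam A b) (Lam A b') (Pi A B)"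
  by (auto simp: checks_def equates_def intro: Pi_intro_eq eq_refl ctx_ext)

lemma equates_App:
  "\<lbrakk>equates \<Gamma> f f' (Pi A B); equates \<Gamma> a a' A; B\<lbrakk>a\<rbrakk> = T\<rbrakk>
    \<Longrightarrow> equates \<Gamma> (App f a) (App f' a') T"
  by (auto simp: equates_def intro: Pi_elim_eq)

lemma equates_beta:
  "\<lbrakk>checks \<Gamma> A (Univ i); checks (A # \<Gamma>) b B; checks \<Gamma> a A; b\<lbrakk>a\<rbrakk> = c; B\<lbrakk>a\<rbrakk> = T\<rbrakk>
    \<Longrightarrow> equates \<Gamma> (App (Lam A b) a) c T"
  by (auto simp: checks_def equates_def intro: Pi_comp ctx_ext)

lemma equates_eta: "checks \<Gamma> f (Pi A B) \<Longrightarrow> equates \<Gamma> (Lam A (App (\<up>f) (Var 0))) f (Pi A B)"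
  by (auto simp: checks_def equates_def intro: Pi_uniq eq_sym)

lemma equates_IndSig_Pair:
  assumes "checks \<Gamma> A (Univ i)" "checks (A # \<Gamma>) B (Univ i)" "checks (Sig A B # \<Gamma>) C (Univ i)"
    and "checks (B # A # \<Gamma>) g (subst (Pair (Var 1) (Var 0) \<cdot> (\<lambda>k. Var (k + 2))) C)"
    and "checks \<Gamma> a A" "checks \<Gamma> b (B\<lbrakk>a\<rbrakk>)"
    and "subst (b \<cdot> a \<cdot> Var) g = c" "C\<lbrakk>Pair a b\<rbrakk> = T"
  shows "equates \<Gamma> (IndSig C g (Pair a b)) c T"
  using assms by (fastforce simp: checks_def equates_def intro: Sig_comp ctx_ext Sig_form)

lemma equates_IndId_Refl:
  assumes "checks \<Gamma> A (Univ i)" "checks (A # \<Gamma>) (\<up>A) (Univ i)"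
    and "checks (\<up>A # A # \<Gamma>) (\<up>(\<up>A)) (Univ i)"
    and "checks (Id (\<up>(\<up>A)) (Var 1) (Var 0) # \<up>A # A # \<Gamma>) C (Univ i)"
    and "checks (A # \<Gamma>) c (subst (Refl (Var 0) \<cdot> Var 0 \<cdot> Var 0 \<cdot> (\<lambda>k. Var (k + 1))) C)"
    and "checks \<Gamma> a A" "c\<lbrakk>a\<rbrakk> = d" "subst (Refl a \<cdot> a \<cdot> a \<cdot> Var) C = T"
  shows "equates \<Gamma> (IndId C c a a (Refl a)) d T"
proof -
  have "checks (\<up>A # A # \<Gamma>) (Id (\<up>(\<up>A)) (Var 1) (Var 0)) (Univ i)"
    using assms(3) by (intro checks_Id checks_Var) (simp_all add: ren_ren comp_def)
  then show ?thesis
    using assms by (auto simp: checks_def equates_def intro!: Id_comp intro: ctx_ext)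
qed

section \<open>Path-induced equivalences are epic\<close>

definition Comp :: "tm \<Rightarrow> tm \<Rightarrow> tm \<Rightarrow> tm" where
  "Comp X u d = Lam X (App (\<up>u) (App (\<up>d) (Var 0)))"

lemma ren_Comp [simp]: "ren r (Comp X u d) = Comp (ren r X) (ren r u) (ren r d)"
  by (simp add: Comp_def)

lemma subst_Comp [simp]: "subst s (Comp X u d) = Comp (subst s X) (subst s u) (subst s d)"
  by (simp add: Comp_def)

text \<open>Two beta steps below the abstraction over \<open>X\<close>: the inner redex yields
  \<open>w\<close>, then the outer one substitutes \<open>w\<close> into \<open>t\<close>. Here
  \<open>ren (upr Suc) t\<close> is the body of the weakened \<open>Lam S t\<close>.\<close>

lemma equates_Comp_beta:
  assumes "checks \<Gamma> X (Univ i)" "checks (X # \<Gamma>) (\<up>X) (Univ i)" "checks (X # \<Gamma>) (\<up>S) (Univ i)"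
    and "checks (\<up>S # X # \<Gamma>) (ren (upr Suc) t) (\<up>(\<up>Z))"
    and "checks (X # \<Gamma>) w (\<up>S)" "checks (\<up>X # X # \<Gamma>) (ren (upr Suc) w) (\<up>(\<up>S))"
  shows "equates \<Gamma> (Comp X (Lam S t) (Lam X w)) (Lam X ((ren (upr Suc) t)\<lbrakk>w\<rbrakk>)) (Pi X (\<up>Z))"
proof -
  have "checks (X # \<Gamma>) (\<up>(Lam S t)) (Pi (\<up>S) (\<up>(\<up>Z)))"
    using assms by (simp add: checks_Lam[where i = i])
  moreover have "checks (X # \<Gamma>) (Var 0) (\<up>X)"
    by (simp add: checks_Var)
  then have "equates (X # \<Gamma>) (App (\<up>(Lam X w)) (Var 0)) w (\<up>S)"
    unfolding ren.simps using assms by (intro equates_beta[where i = i and B = "\<up>(\<up>S)"]) simp_all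
  ultimately have "equates (X # \<Gamma>) (App (\<up>(Lam S t)) (App (\<up>(Lam X w)) (Var 0)))
      (App (\<up>(Lam S t)) w) (\<up>Z)"
    by (rule equates_App[OF equates_refl]) simp
  moreover have "equates (X # \<Gamma>) (App (\<up>(Lam S t)) w) ((ren (upr Suc) t)\<lbrakk>w\<rbrakk>) (\<up>Z)"
    unfolding ren.simps using assms by (intro equates_beta[where i = i and B = "\<up>(\<up>Z)"]) simp_all
  ultimately have "equates (X # \<Gamma>) (App (\<up>(Lam S t)) (App (\<up>(Lam X w)) (Var 0)))
      ((ren (upr Suc) t)\<lbrakk>w\<rbrakk>) (\<up>Z)"
    by (rule equates_trans)
  then show ?thesis
    unfolding Comp_def by (rule equates_Lam[OF assms(1)])
qed

declare Apps.simps [simp del]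

context
  fixes i :: nat
begin

text \<open>In the rules for \<open>Lam\<close>, \<open>Refl\<close> and \<open>Pair\<close> the
  level occurs in premises only, so it is fixed to \<open>Suc i\<close>, where \<open>Univ i\<close>
  itself is a type. Indices are put in successor form so that context lookup computes.\<close>

lemmas checks_simps =
  checks_Var checks_Var_cumul checks_Univ checks_Pi checks_Sig checks_Id checks_App_Var
  checks_Lam[where i = "Suc i"] checks_Refl[where i = "Suc i"] checks_Pair[where i = "Suc i"]
  numeral_eq_Suc Arr_def

section \<open>Typing of \<open>idtofun\<close> and its computation at reflexivity\<close>

lemma checks_idtofun:
  assumes "checks \<Gamma> X (Univ i)" "checks \<Gamma> Y (Univ i)"
    and "checks (Id (Univ i) X Y # \<Gamma>) (\<up>X) (Univ i)" "checks (Id (Univ i) X Y # \<Gamma>) (\<up>Y) (Univ i)"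
  shows "checks \<Gamma> (idtofun i X Y) (Pi (Id (Univ i) X Y) (Pi (\<up>X) (\<up>(\<up>Y))))"
  unfolding idtofun_def
  by (rule checks_Lam[where i = "Suc i"]; (rule checks_IndId[where A = "Univ i" and i = "Suc i"])?)
    (use assms in \<open>simp_all add: checks_simps\<close>)

lemma checks_App_idtofun:
  assumes "checks \<Gamma> X (Univ i)" "checks \<Gamma> Y (Univ i)"
    and "checks (Id (Univ i) X Y # \<Gamma>) (\<up>X) (Univ i)" "checks (Id (Univ i) X Y # \<Gamma>) (\<up>Y) (Univ i)"
    and "checks \<Gamma> p (Id (Univ i) X Y)" "Pi X (\<up>Y) = T"
  shows "checks \<Gamma> (App (idtofun i X Y) p) T"
  by (rule checks_App[OF checks_idtofun]) (use assms in simp_all)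

lemma checks_App_App_idtofun:
  assumes "checks \<Gamma> X (Univ i)" "checks \<Gamma> Y (Univ i)"
    and "checks (Id (Univ i) X Y # \<Gamma>) (\<up>X) (Univ i)" "checks (Id (Univ i) X Y # \<Gamma>) (\<up>Y) (Univ i)"
    and "checks \<Gamma> p (Id (Univ i) X Y)" "checks \<Gamma> x X"
  shows "checks \<Gamma> (App (App (idtofun i X Y) p) x) Y"
  by (rule checks_App[OF checks_App_idtofun[OF _ _ _ _ _ refl]]) (use assms in simp_all)

text \<open>Three computations: beta for \<open>idtofun\<close>, the computation rule of path
  induction, and beta for the resulting identity function.\<close>

lemma equates_idtofun_Refl:
  assumes "k < length \<Gamma>" "\<Gamma> ! k = Univ i" "checks \<Gamma> x (Var k)"
  shows "equates \<Gamma> (App (App (idtofun i (Var k) (Var k)) (Refl (Var k))) x) x (Var k)"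
proof -
  let ?J = "IndId (Var 2 \<rightarrow>\<^sub>t Var 1) (Lam (Var 0) (Var 0)) (Var k) (Var k) (Refl (Var k))"
  let ?T = "Pi (Var k) (Var (Suc k))"
  have "equates \<Gamma> (App (idtofun i (Var k) (Var k)) (Refl (Var k))) ?J ?T"
    unfolding idtofun_def
    by (rule equates_beta[where i = "Suc i" and B = "Pi (Var (Suc k)) (Var (Suc (Suc k)))"];
        (rule checks_IndId[where A = "Univ i" and i = "Suc i"])?)
      (use assms in \<open>simp_all add: checks_simps\<close>)
  moreover have "equates \<Gamma> ?J (Lam (Var k) (Var 0)) ?T"
    by (rule equates_IndId_Refl[where A = "Univ i" and i = "Suc i"])
      (use assms in \<open>simp_all add: checks_simps\<close>)
  ultimately have "equates \<Gamma> (App (idtofun i (Var k) (Var k)) (Refl (Var k))) (Lam (Var k) (Var 0)) ?T"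
    by (rule equates_trans)
  then have "equates \<Gamma> (App (App (idtofun i (Var k) (Var k)) (Refl (Var k))) x)
      (App (Lam (Var k) (Var 0)) x) (Var k)"
    by (rule equates_App) (use assms in \<open>simp_all add: equates_refl\<close>)
  moreover have "equates \<Gamma> (App (Lam (Var k) (Var 0)) x) x (Var k)"
    by (rule equates_beta[where i = "Suc i" and B = "Var (Suc k)"])
      (use assms in \<open>simp_all add: checks_simps\<close>)
  ultimately show ?thesis by (rule equates_trans)
qed

text \<open>By the previous lemma the composite is the eta-expansion of \<open>Var u\<close>, so
  judgmental eta closes the gap. The codomain is \<open>Var l\<close>, written
  \<open>Var (Suc l)\<close> below the binder.\<close>

lemma equates_Comp_idtofun_Refl:
  assumes "k < length \<Gamma>" "\<Gamma> ! k = Univ i" "u < length \<Gamma>"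
    and "ren (\<lambda>j. j + Suc u) (\<Gamma> ! u) = Pi (Var k) (Var (Suc l))"
  shows "equates \<Gamma> (Comp (Var k) (Var u) (App (idtofun i (Var k) (Var k)) (Refl (Var k)))) (Var u)
    (Pi (Var k) (Var (Suc l)))"
proof -
  have "ren (\<lambda>j. j + Suc (Suc u)) (\<Gamma> ! u) = \<up>(ren (\<lambda>j. j + Suc u) (\<Gamma> ! u))"
    by (simp add: ren_ren comp_def)
  then have u: "checks (Var k # \<Gamma>) (Var (Suc u)) (Pi (Var (Suc k)) (Var (Suc (Suc l))))"
    using assms by (intro checks_Var) simp_all
  have "equates (Var k # \<Gamma>)
      (App (Var (Suc u)) (App (App (idtofun i (Var (Suc k)) (Var (Suc k))) (Refl (Var (Suc k)))) (Var 0)))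
      (App (Var (Suc u)) (Var 0)) (Var (Suc l))"
    by (rule equates_App[OF equates_refl[OF u] equates_idtofun_Refl])
      (use assms in \<open>simp_all add: checks_simps\<close>)
  then have "equates \<Gamma> (Comp (Var k) (Var u) (App (idtofun i (Var k) (Var k)) (Refl (Var k))))
      (Lam (Var k) (App (Var (Suc u)) (Var 0))) (Pi (Var k) (Var (Suc l)))"
    unfolding Comp_def
    by (simp, intro equates_Lam[where i = i]) (use assms in \<open>simp_all add: checks_simps\<close>)
  moreover have "equates \<Gamma> (Lam (Var k) (App (Var (Suc u)) (Var 0))) (Var u) (Pi (Var k) (Var (Suc l)))"
    using equates_eta[of \<Gamma> "Var u"] checks_Var[OF assms(3,4)] by simp
  ultimately show ?thesis by (rule equates_trans)
qed


section \<open>Cancelling a path-induced equivalence on the right\<close>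

text \<open>
  $\prod_{Z : \mathcal U} \prod_{u, v : Y \to Z}
  (u \circ \mathrm{idtofun}(p) = v \circ \mathrm{idtofun}(p)) \to u = v$, where $X, Y, p$ have
  indices 2, 1, 0.
\<close>

definition precomp_idtofun_cancel_motive :: tm where
  "precomp_idtofun_cancel_motive =
    Pi (Univ i) (Pi (Var 2 \<rightarrow>\<^sub>t Var 0) (Pi (Var 3 \<rightarrow>\<^sub>t Var 1)
      (Id (Var 5 \<rightarrow>\<^sub>t Var 2) (Comp (Var 5) (Var 1) (App (idtofun i (Var 5) (Var 4)) (Var 3)))
        (Comp (Var 5) (Var 0) (App (idtofun i (Var 5) (Var 4)) (Var 3))) \<rightarrow>\<^sub>t
       Id (Var 4 \<rightarrow>\<^sub>t Var 2) (Var 1) (Var 0))))"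

definition precomp_idtofun_cancel_type :: tm where
  "precomp_idtofun_cancel_type =
    Pi (Univ i) (Pi (Univ i) (Pi (Id (Univ i) (Var 1) (Var 0)) precomp_idtofun_cancel_motive))"

text \<open>The motive quantifies over Z, u and v because the types of u and v depend on the
  endpoint Y. In the reflexivity case the hypothesis itself, \<open>Var 0\<close>, is the proof, up
  to conversion.\<close>

definition precomp_idtofun_cancel :: tm where
  "precomp_idtofun_cancel =
    Lam (Univ i) (Lam (Univ i) (Lam (Id (Univ i) (Var 1) (Var 0))
      (IndId precomp_idtofun_cancel_motive
        (Lam (Univ i) (Lam (Var 1 \<rightarrow>\<^sub>t Var 0) (Lam (Var 2 \<rightarrow>\<^sub>t Var 1)
          (Lam (Id (Var 3 \<rightarrow>\<^sub>t Var 2)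
              (Comp (Var 3) (Var 1) (App (idtofun i (Var 3) (Var 3)) (Refl (Var 3))))
              (Comp (Var 3) (Var 0) (App (idtofun i (Var 3) (Var 3)) (Refl (Var 3)))))
            (Var 0)))))
        (Var 2) (Var 1) (Var 0))))"

lemmas checks_Comp_simps =
  checks_simps checks_App_idtofun checks_App_App_idtofun Comp_def

lemma checks_precomp_idtofun_cancel:
  "checks \<Gamma> precomp_idtofun_cancel precomp_idtofun_cancel_type"
proof -
  \<comment> \<open>The reflexivity case is where the required type agrees with the given one only
    judgmentally: both composites reduce, to u and to v.\<close>
  have base: "checks (Id (Var 3 \<rightarrow>\<^sub>t Var 2)
              (Comp (Var 3) (Var 1) (App (idtofun i (Var 3) (Var 3)) (Refl (Var 3))))
              (Comp (Var 3) (Var 0) (App (idtofun i (Var 3) (Var 3)) (Refl (Var 3)))) #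
      (Var 2 \<rightarrow>\<^sub>t Var 1) # (Var 1 \<rightarrow>\<^sub>t Var 0) # Univ i # Univ i # \<Delta>) (Var 0)
      (Id (Var 4 \<rightarrow>\<^sub>t Var 3) (Var 2) (Var 1))" (is "checks ?\<Delta> _ _") for \<Delta>
  proof (rule checks_conv)
    let ?c = "\<lambda>u. Comp (Var 4) (Var u) (App (idtofun i (Var 4) (Var 4)) (Refl (Var 4)))"
    show "checks ?\<Delta> (Var 0) (Id (Var 4 \<rightarrow>\<^sub>t Var 3) (?c 2) (?c 1))"
      by (rule checks_Var) (simp_all add: Arr_def numeral_eq_Suc)
    show "equates ?\<Delta> (Id (Var 4 \<rightarrow>\<^sub>t Var 3) (?c 2) (?c 1)) (Id (Var 4 \<rightarrow>\<^sub>t Var 3) (Var 2) (Var 1))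
        (Univ i)"
      by (simp add: equates_Id equates_Comp_idtofun_Refl checks_simps)
  qed
  show ?thesis
    unfolding precomp_idtofun_cancel_def precomp_idtofun_cancel_type_def
    by (intro checks_Lam[where i = "Suc i"];
        (rule checks_IndId[where A = "Univ i" and i = "Suc i"])?)
      (use base in \<open>simp_all add: precomp_idtofun_cancel_motive_def checks_Comp_simps\<close>)
qed


text \<open>
  $(u \circ d = v \circ d) \to (u \circ d' = v \circ d')$, where $d$, $d'$ and the path between
  them have indices 2, 1, 0.
\<close>

definition eq_Comp_transport_motive :: "nat \<Rightarrow> nat \<Rightarrow> nat \<Rightarrow> nat \<Rightarrow> tm" where
  "eq_Comp_transport_motive X Z u v =
    (Id (Var X \<rightarrow>\<^sub>t Var Z) (Comp (Var X) (Var u) (Var 2)) (Comp (Var X) (Var v) (Var 2)) \<rightarrow>\<^sub>t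
     Id (Var X \<rightarrow>\<^sub>t Var Z) (Comp (Var X) (Var u) (Var 1)) (Comp (Var X) (Var v) (Var 1)))"

definition eq_Comp_transport_type :: tm where
  "eq_Comp_transport_type =
    Pi (Univ i) (Pi (Univ i) (Pi (Univ i)
      (Pi (Var 1 \<rightarrow>\<^sub>t Var 0) (Pi (Var 2 \<rightarrow>\<^sub>t Var 1) (Pi (Var 4 \<rightarrow>\<^sub>t Var 3) (Pi (Var 5 \<rightarrow>\<^sub>t Var 4)
        (Pi (Id (Var 6 \<rightarrow>\<^sub>t Var 5) (Var 1) (Var 0)) (eq_Comp_transport_motive 7 5 4 3))))))))"

text \<open>Since \<open>isPIE\<close> supplies only a path from d to idtofun(p), a hypothesis about
  d has to be transported along it. The arguments \<open>10 8 7 6\<close> are \<open>7 5 4 3\<close>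
  shifted past the three variables bound by the motive.\<close>

definition eq_Comp_transport :: tm where
  "eq_Comp_transport =
    Lam (Univ i) (Lam (Univ i) (Lam (Univ i)
      (Lam (Var 1 \<rightarrow>\<^sub>t Var 0) (Lam (Var 2 \<rightarrow>\<^sub>t Var 1) (Lam (Var 4 \<rightarrow>\<^sub>t Var 3) (Lam (Var 5 \<rightarrow>\<^sub>t Var 4)
        (Lam (Id (Var 6 \<rightarrow>\<^sub>t Var 5) (Var 1) (Var 0))
          (IndId (eq_Comp_transport_motive 10 8 7 6)
            (Lam (Id (Var 8 \<rightarrow>\<^sub>t Var 6) (Comp (Var 8) (Var 5) (Var 0)) (Comp (Var 8) (Var 4) (Var 0)))
              (Var 0))
            (Var 2) (Var 1) (Var 0)))))))))"

lemma checks_eq_Comp_transport: "checks \<Gamma> eq_Comp_transport eq_Comp_transport_type"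
  unfolding eq_Comp_transport_def eq_Comp_transport_type_def
  by (intro checks_Lam[where i = "Suc i"];
      (rule checks_IndId[where A = "Var 7 \<rightarrow>\<^sub>t Var 6" and i = "Suc i"])?)
    (simp_all add: eq_Comp_transport_motive_def checks_Comp_simps)

text \<open>
  $\prod_{X, Y, Z : \mathcal U} \prod_{k : X \to Y} \prod_{u, v : Y \to Z}
  u = v \to u \circ k = v \circ k$
\<close>

definition ap_Comp_type :: tm where
  "ap_Comp_type =
    Pi (Univ i) (Pi (Univ i) (Pi (Univ i)
      (Pi (Var 2 \<rightarrow>\<^sub>t Var 1) (Pi (Var 2 \<rightarrow>\<^sub>t Var 1) (Pi (Var 3 \<rightarrow>\<^sub>t Var 2)
        (Pi (Id (Var 4 \<rightarrow>\<^sub>t Var 3) (Var 1) (Var 0))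
          (Id (Var 6 \<rightarrow>\<^sub>t Var 4) (Comp (Var 6) (Var 2) (Var 3)) (Comp (Var 6) (Var 1) (Var 3)))))))))"

definition ap_Comp :: tm where
  "ap_Comp =
    Lam (Univ i) (Lam (Univ i) (Lam (Univ i)
      (Lam (Var 2 \<rightarrow>\<^sub>t Var 1) (Lam (Var 2 \<rightarrow>\<^sub>t Var 1) (Lam (Var 3 \<rightarrow>\<^sub>t Var 2)
        (Lam (Id (Var 4 \<rightarrow>\<^sub>t Var 3) (Var 1) (Var 0))
          (IndId (Id (Var 9 \<rightarrow>\<^sub>t Var 7) (Comp (Var 9) (Var 2) (Var 6)) (Comp (Var 9) (Var 1) (Var 6)))
            (Refl (Comp (Var 7) (Var 0) (Var 4))) (Var 2) (Var 1) (Var 0))))))))"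

lemma checks_ap_Comp: "checks \<Gamma> ap_Comp ap_Comp_type"
  unfolding ap_Comp_def ap_Comp_type_def
  by (intro checks_Lam[where i = "Suc i"];
      (rule checks_IndId[where A = "Var 5 \<rightarrow>\<^sub>t Var 4" and i = "Suc i"])?)
    (simp_all add: checks_Comp_simps)

text \<open>
  $\prod_{Z : \mathcal U} \prod_{u, v : Y \to Z} (u \circ d = v \circ d) \to u = v$, where
  $X, Y, d$ have indices 3, 2, 1 and index 0 is a proof of $\mathrm{isPIE}(d)$.
\<close>

definition PIE_cancel_body :: tm where
  "PIE_cancel_body =
    Pi (Univ i) (Pi (Var 3 \<rightarrow>\<^sub>t Var 0) (Pi (Var 4 \<rightarrow>\<^sub>t Var 1)
      (Id (Var 6 \<rightarrow>\<^sub>t Var 2) (Comp (Var 6) (Var 1) (Var 4)) (Comp (Var 6) (Var 0) (Var 4)) \<rightarrow>\<^sub>t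
       Id (Var 5 \<rightarrow>\<^sub>t Var 2) (Var 1) (Var 0))))"

definition PIE_cancel_type :: tm where
  "PIE_cancel_type =
    Pi (Univ i) (Pi (Univ i) (Pi (Var 1 \<rightarrow>\<^sub>t Var 0) (Pi (isPIE i (Var 2) (Var 1) (Var 0))
      PIE_cancel_body)))"

text \<open>Splitting the proof of \<open>isPIE\<close> gives p and q, with q a path from d to
  idtofun(p). The hypothesis is transported along q, and then idtofun(p) is cancelled. In the
  innermost term the indices 9 down to 0 are X, Y, d, the \<open>isPIE\<close> proof, p, q, Z, u, v
  and the hypothesis.\<close>

definition PIE_cancel :: tm where
  "PIE_cancel =
    Lam (Univ i) (Lam (Univ i) (Lam (Var 1 \<rightarrow>\<^sub>t Var 0) (Lam (isPIE i (Var 2) (Var 1) (Var 0))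
      (IndSig (\<up>PIE_cancel_body)
        (Lam (Univ i) (Lam (Var 5 \<rightarrow>\<^sub>t Var 0) (Lam (Var 6 \<rightarrow>\<^sub>t Var 1)
          (Lam (Id (Var 8 \<rightarrow>\<^sub>t Var 2) (Comp (Var 8) (Var 1) (Var 6)) (Comp (Var 8) (Var 0) (Var 6)))
            (Apps precomp_idtofun_cancel
              [Var 9, Var 8, Var 5, Var 3, Var 2, Var 1,
               Apps eq_Comp_transport
                 [Var 9, Var 8, Var 3, Var 2, Var 1, Var 7,
                  App (idtofun i (Var 9) (Var 8)) (Var 5), Var 4, Var 0]])))))
        (Var 0)))))"

lemma checks_PIE_cancel: "checks \<Gamma> PIE_cancel PIE_cancel_type"
  unfolding PIE_cancel_def PIE_cancel_type_def
  by (intro checks_Lam[where i = "Suc i"];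
      (rule checks_IndSig[where i = "Suc i" and A = "Id (Univ i) (Var 3) (Var 2)"
        and B = "Id (Var 4 \<rightarrow>\<^sub>t Var 3) (Var 2) (App (idtofun i (Var 4) (Var 3)) (Var 0))"])?)
    (simp_all add: isPIE_def PIE_cancel_body_def checks_Comp_simps
      checks_Apps[OF checks_precomp_idtofun_cancel,
        unfolded precomp_idtofun_cancel_type_def precomp_idtofun_cancel_motive_def]
      checks_Apps[OF checks_eq_Comp_transport,
        unfolded eq_Comp_transport_type_def eq_Comp_transport_motive_def])

section \<open>The endpoint projections of the diagonal\<close>

definition src :: "tm \<Rightarrow> tm \<Rightarrow> tm" where
  "src X w = IndSig (\<up>X) (Var 1) w"

text \<open>The second component is again a pair, hence the nested eliminator. Its motive is lifted
  three times: past the two variables of the outer branch and past its own variable.\<close>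

definition tgt :: "tm \<Rightarrow> tm \<Rightarrow> tm" where
  "tgt X w = IndSig (\<up>X) (IndSig (\<up>(\<up>(\<up>X))) (Var 1) (Var 0)) w"

lemma ren_src_tgt [simp]:
  "ren r (src X w) = src (ren r X) (ren r w)"
  "ren r (tgt X w) = tgt (ren r X) (ren r w)"
  by (simp_all add: src_def tgt_def)

lemma subst_src_tgt [simp]:
  "subst s (src X w) = src (subst s X) (subst s w)"
  "subst s (tgt X w) = tgt (subst s X) (subst s w)"
  by (simp_all add: src_def tgt_def)

lemma checks_src:
  assumes "k < length \<Gamma>" "\<Gamma> ! k = Univ i" "checks \<Gamma> w (Diag (Var k))"
  shows "checks \<Gamma> (src (Var k) w) (Var k)"
  unfolding src_def
  by (rule checks_IndSig[OF _ _ _ _ assms(3)[unfolded Diag_def], where i = i])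
    (use assms in \<open>simp_all add: checks_simps\<close>)

lemma checks_tgt_branch:
  assumes "k < length \<Gamma>" "\<Gamma> ! k = Univ i"
  shows "checks (Sig (Var (Suc k)) (Id (Var (Suc (Suc k))) (Var 1) (Var 0)) # Var k # \<Gamma>)
    (IndSig (Var (Suc (Suc (Suc k)))) (Var 1) (Var 0)) (Var (Suc (Suc k)))"
  by (rule checks_IndSig[where i = i and A = "Var (Suc (Suc k))"
        and B = "Id (Var (Suc (Suc (Suc k)))) (Var 2) (Var 0)"])
    (use assms in \<open>simp_all add: checks_simps\<close>)

lemma checks_tgt:
  assumes "k < length \<Gamma>" "\<Gamma> ! k = Univ i" "checks \<Gamma> w (Diag (Var k))"
  shows "checks \<Gamma> (tgt (Var k) w) (Var k)"
  unfolding tgt_def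
  by (rule checks_IndSig[OF _ _ _ _ assms(3)[unfolded Diag_def], where i = i])
    (use assms checks_tgt_branch[OF assms(1,2)] in \<open>simp_all add: checks_simps\<close>)

lemma equates_src:
  assumes "k < length \<Gamma>" "\<Gamma> ! k = Univ i"
    and "checks \<Gamma> a (Var k)" "checks (Var k # \<Gamma>) (\<up>a) (Var (Suc k))"
    and "checks \<Gamma> b (Var k)" "checks \<Gamma> q (Id (Var k) a b)"
  shows "equates \<Gamma> (src (Var k) (Pair a (Pair b q))) a (Var k)"
  unfolding src_def
  by (rule equates_IndSig_Pair[where i = "Suc i" and A = "Var k"
      and B = "Sig (Var (Suc k)) (Id (Var (Suc (Suc k))) (Var 1) (Var 0))"])
    (use assms in \<open>simp_all add: checks_simps\<close>)

text \<open>The outer eliminator reduces first and exposes the inner one at \<open>Pair b q\<close>.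
  By then \<open>a\<close> has replaced the bound variable in the type of that pair.\<close>

lemma equates_tgt:
  assumes "k < length \<Gamma>" "\<Gamma> ! k = Univ i"
    and "checks \<Gamma> a (Var k)" "checks (Var k # \<Gamma>) (\<up>a) (Var (Suc k))"
    and "checks \<Gamma> b (Var k)" "checks \<Gamma> q (Id (Var k) a b)"
  shows "equates \<Gamma> (tgt (Var k) (Pair a (Pair b q))) b (Var k)"
proof (rule equates_trans)
  show "equates \<Gamma> (tgt (Var k) (Pair a (Pair b q))) (IndSig (Var (Suc k)) (Var 1) (Pair b q)) (Var k)"
    unfolding tgt_def
    by (rule equates_IndSig_Pair[where i = "Suc i" and A = "Var k"
          and B = "Sig (Var (Suc k)) (Id (Var (Suc (Suc k))) (Var 1) (Var 0))"])
      (use assms checks_tgt_branch[OF assms(1,2)] in \<open>simp_all add: checks_simps\<close>)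
  show "equates \<Gamma> (IndSig (Var (Suc k)) (Var 1) (Pair b q)) b (Var k)"
    by (rule equates_IndSig_Pair[where i = "Suc i" and A = "Var k"
      and B = "Id (Var (Suc k)) (\<up>a) (Var 0)"])
      (use assms in \<open>simp_all add: checks_simps\<close>)
qed


lemma checks_Diag:
  "\<lbrakk>k < length \<Gamma>; \<Gamma> ! k = Univ i\<rbrakk> \<Longrightarrow> checks \<Gamma> (Diag (Var k)) (Univ i)"
  "\<lbrakk>k < length \<Gamma>; \<Gamma> ! k = Univ i\<rbrakk> \<Longrightarrow> checks \<Gamma> (Diag (Var k)) (Univ (Suc i))"
  by (simp_all add: Diag_def checks_simps)

lemma checks_Pair_Diag:
  assumes "k < length \<Gamma>" "\<Gamma> ! k = Univ i"
    and "checks \<Gamma> a (Var k)" "checks (Var k # \<Gamma>) (\<up>a) (Var (Suc k))"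
    and "checks \<Gamma> b (Var k)" "checks \<Gamma> q (Id (Var k) a b)"
  shows "checks \<Gamma> (Pair a (Pair b q)) (Diag (Var k))"
  using assms by (simp add: Diag_def checks_simps)

definition src_map :: "tm \<Rightarrow> tm" where
  "src_map X = Lam (Diag X) (src (\<up>X) (Var 0))"

definition tgt_map :: "tm \<Rightarrow> tm" where
  "tgt_map X = Lam (Diag X) (tgt (\<up>X) (Var 0))"

lemma checks_src_map:
  "\<lbrakk>k < length \<Gamma>; \<Gamma> ! k = Univ i\<rbrakk> \<Longrightarrow> checks \<Gamma> (src_map (Var k)) (Pi (Diag (Var k)) (Var (Suc k)))"
  by (simp add: src_map_def checks_src checks_Diag checks_simps)

lemma checks_tgt_map:
  "\<lbrakk>k < length \<Gamma>; \<Gamma> ! k = Univ i\<rbrakk> \<Longrightarrow> checks \<Gamma> (tgt_map (Var k)) (Pi (Diag (Var k)) (Var (Suc k)))"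
  by (simp add: tgt_map_def checks_tgt checks_Diag checks_simps)

lemma checks_diag_map:
  "\<lbrakk>k < length \<Gamma>; \<Gamma> ! k = Univ i\<rbrakk> \<Longrightarrow> checks \<Gamma> (diag_map (Var k)) (Pi (Var k) (Diag (Var (Suc k))))"
  by (simp add: diag_map_def checks_Pair_Diag checks_simps)

text \<open>Beta-reduce the composite, then project below the abstraction. This serves both the
  diagonal map, where \<open>m\<close> is \<open>k\<close>, and the graph of a homotopy.\<close>

lemma equates_Comp_src_tgt_map:
  fixes a b q :: tm and \<Gamma> :: "tm list" and k m :: nat
  defines "w \<equiv> Pair a (Pair b q)" and "\<Delta> \<equiv> Var m # \<Gamma>"
  assumes "k < length \<Gamma>" "\<Gamma> ! k = Univ i" "m < length \<Gamma>" "\<Gamma> ! m = Univ i"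
    and "checks \<Delta> a (Var (Suc k))" "checks (Var (Suc k) # \<Delta>) (\<up>a) (Var (Suc (Suc k)))"
      "checks \<Delta> b (Var (Suc k))" "checks \<Delta> q (Id (Var (Suc k)) a b)"
    and "checks (Var (Suc m) # \<Delta>) (ren (upr Suc) w) (Diag (Var (Suc (Suc k))))"
  shows "equates \<Gamma> (Comp (Var m) (src_map (Var k)) (Lam (Var m) w)) (Lam (Var m) a)
      (Pi (Var m) (Var (Suc k)))"
    and "equates \<Gamma> (Comp (Var m) (tgt_map (Var k)) (Lam (Var m) w)) (Lam (Var m) b)
      (Pi (Var m) (Var (Suc k)))"
proof -
  have w: "checks \<Delta> w (Diag (Var (Suc k)))"
    unfolding w_def by (rule checks_Pair_Diag) (use assms in simp_all)
  have "equates \<Gamma> (Comp (Var m) (src_map (Var k)) (Lam (Var m) w)) (Lam (Var m) (src (Var (Suc k)) w))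
      (Pi (Var m) (Var (Suc k)))"
    using equates_Comp_beta[of \<Gamma> "Var m" "Suc i" "Diag (Var k)"
      "src (Var (Suc k)) (Var 0)" "Var k" w] assms w
    by (simp add: src_map_def checks_src checks_Diag checks_simps)
  moreover have "equates \<Gamma> (Lam (Var m) (src (Var (Suc k)) w)) (Lam (Var m) a) (Pi (Var m) (Var (Suc k)))"
    using assms by (intro equates_Lam[where i = "Suc i"]) (simp_all add: equates_src checks_simps)
  ultimately show "equates \<Gamma> (Comp (Var m) (src_map (Var k)) (Lam (Var m) w)) (Lam (Var m) a)
      (Pi (Var m) (Var (Suc k)))"
    by (rule equates_trans)
  have "equates \<Gamma> (Comp (Var m) (tgt_map (Var k)) (Lam (Var m) w)) (Lam (Var m) (tgt (Var (Suc k)) w))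
      (Pi (Var m) (Var (Suc k)))"
    using equates_Comp_beta[of \<Gamma> "Var m" "Suc i" "Diag (Var k)"
      "tgt (Var (Suc k)) (Var 0)" "Var k" w] assms w
    by (simp add: tgt_map_def checks_tgt checks_Diag checks_simps)
  moreover have "equates \<Gamma> (Lam (Var m) (tgt (Var (Suc k)) w)) (Lam (Var m) b) (Pi (Var m) (Var (Suc k)))"
    using assms by (intro equates_Lam[where i = "Suc i"]) (simp_all add: equates_tgt checks_simps)
  ultimately show "equates \<Gamma> (Comp (Var m) (tgt_map (Var k)) (Lam (Var m) w)) (Lam (Var m) b)
      (Pi (Var m) (Var (Suc k)))"
    by (rule equates_trans)
qed

definition src_eq_tgt :: "tm \<Rightarrow> tm \<Rightarrow> tm" where
  "src_eq_tgt B D = Apps PIE_cancel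
    [B, Diag B, diag_map B, App D B, B, src_map B, tgt_map B, Refl (Lam B (Var 0))]"

lemma checks_src_eq_tgt:
  assumes "k < length \<Gamma>" "\<Gamma> ! k = Univ i" "l < length \<Gamma>" "\<Gamma> ! l = diag_maps_PIE i"
  shows "checks \<Gamma> (src_eq_tgt (Var k) (Var l))
    (Id (Pi (Diag (Var k)) (Var (Suc k))) (src_map (Var k)) (tgt_map (Var k)))"
proof -
  have 1: "checks \<Gamma> (App (Var l) (Var k)) (isPIE i (Var k) (Diag (Var k)) (diag_map (Var k)))"
    using assms
    by (simp add: checks_simps diag_maps_PIE_def isPIE_def diag_map_def)
  \<comment> \<open>Both composites compute to the identity on \<open>Var k\<close>, so reflexivity
    at the identity gets this type by conversion.\<close>
  have 2: "checks \<Gamma> (Refl (Lam (Var k) (Var 0))) (Id (Pi (Var k) (Var (Suc k)))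
     (Comp (Var k) (src_map (Var k)) (diag_map (Var k)))
     (Comp (Var k) (tgt_map (Var k)) (diag_map (Var k))))"
    unfolding diag_map_def
    by (rule checks_conv[OF checks_Refl[where i = "Suc i"] equates_Id[where i = "Suc i"]];
        (rule equates_sym, rule equates_Comp_src_tgt_map)?)
      (use assms in \<open>simp_all add: checks_simps checks_Pair_Diag\<close>)
  show ?thesis
    unfolding src_eq_tgt_def
    by (rule checks_Apps[OF checks_PIE_cancel])
      (use assms 1 2 in \<open>simp add: PIE_cancel_type_def PIE_cancel_body_def checks_simps checks_Diag
        checks_src_map checks_tgt_map checks_diag_map\<close>)
qed


section \<open>Function extensionality from the equality of the projections\<close>

text \<open>
  In the context of $D, A, B, f, g, h$ with indices 5 down to 0, where $D$ is the hypothesis on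
  diagonal maps, this is $k = \lambda a.\, (f(a), g(a), h(a))$.
\<close>

definition homotopy_graph :: tm where
  "homotopy_graph =
    Lam (Var 4) (Pair (App (Var 3) (Var 0)) (Pair (App (Var 2) (Var 0)) (App (Var 1) (Var 0))))"

text \<open>Precomposes the path between the two projections with the graph. The resulting path
  joins the two composites, which are f and g up to conversion.\<close>

definition homotopic_imp_eq_body :: tm where
  "homotopic_imp_eq_body = Apps ap_Comp
    [Var 4, Diag (Var 3), Var 3, homotopy_graph, src_map (Var 3), tgt_map (Var 3),
     src_eq_tgt (Var 3) (Var 5)]"

lemma checks_homotopic_imp_eq_body:
  "checks (Homotopy (Var 3) (Var 2) (Var 1) (Var 0) # (Var 2 \<rightarrow>\<^sub>t Var 1) # (Var 1 \<rightarrow>\<^sub>t Var 0) #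
      Univ i # Univ i # diag_maps_PIE i # \<Gamma>)
    homotopic_imp_eq_body (Id (Var 4 \<rightarrow>\<^sub>t Var 3) (Var 2) (Var 1))" (is "checks ?\<Gamma> _ _")
proof (rule checks_conv)
  \<comment> \<open>The first \<open>Var 4\<close> is A; the second lies below the binder and is
    B.\<close>
  let ?T = "Pi (Var 4) (Var 4)"
  let ?s = "Comp (Var 4) (src_map (Var 3)) homotopy_graph"
    and ?t = "Comp (Var 4) (tgt_map (Var 3)) homotopy_graph"
  have graph: "checks ?\<Gamma> homotopy_graph (Pi (Var 4) (Diag (Var 4)))"
    by (simp add: homotopy_graph_def Homotopy_def checks_Pair_Diag checks_simps)
  show "checks ?\<Gamma> homotopic_imp_eq_body (Id ?T ?s ?t)"
    unfolding homotopic_imp_eq_body_def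
    by (rule checks_Apps[OF checks_ap_Comp])
      (use graph in \<open>simp add: ap_Comp_type_def checks_simps checks_Diag
        checks_src_map checks_tgt_map checks_src_eq_tgt\<close>)
  have "equates ?\<Gamma> ?s (Lam (Var 4) (App (Var 3) (Var 0))) (Pi (Var 4) (Var (Suc 3)))"
    unfolding homotopy_graph_def
    by (rule equates_Comp_src_tgt_map)
      (simp_all add: Homotopy_def checks_simps checks_Pair_Diag)
  moreover have "equates ?\<Gamma> ?t (Lam (Var 4) (App (Var 2) (Var 0))) (Pi (Var 4) (Var (Suc 3)))"
    unfolding homotopy_graph_def
    by (rule equates_Comp_src_tgt_map)
      (simp_all add: Homotopy_def checks_simps checks_Pair_Diag)
  \<comment> \<open>Beta leaves the eta-expansions of f and g; eta removes them.\<close>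
  moreover have "equates ?\<Gamma> (Lam (Var 4) (App (Var 3) (Var 0))) (Var 2) (Pi (Var 4) (Var (Suc 3)))"
     "equates ?\<Gamma> (Lam (Var 4) (App (Var 2) (Var 0))) (Var 1) (Pi (Var 4) (Var (Suc 3)))"
    using equates_eta[of ?\<Gamma> "Var 2" "Var 4" "Var (Suc 3)"]
      equates_eta[of ?\<Gamma> "Var 1" "Var 4" "Var (Suc 3)"]
    by (simp_all add: checks_simps)
  ultimately have "equates ?\<Gamma> ?s (Var 2) ?T" "equates ?\<Gamma> ?t (Var 1) ?T"
    by (auto intro: equates_trans)
  then show "equates ?\<Gamma> (Id ?T ?s ?t) (Id (Var 4 \<rightarrow>\<^sub>t Var 3) (Var 2) (Var 1)) (Univ i)"
    by (simp add: equates_Id checks_simps)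
qed

lemma checks_PIE_closed_under_homotopies:
  "checks \<Gamma> (PIE_closed_under_homotopies i) (Univ (Suc i))"
  by (simp add: PIE_closed_under_homotopies_def isPIE_def Homotopy_def checks_Comp_simps)

lemma checks_diag_maps_PIE: "checks \<Gamma> (diag_maps_PIE i) (Univ (Suc i))"
  by (simp add: diag_maps_PIE_def isPIE_def checks_Comp_simps checks_Diag checks_diag_map)

end

theorem theorem2p39:
  fixes i :: nat
  shows "inhabited (PIE_closed_under_homotopies i \<rightarrow>\<^sub>t diag_maps_PIE i \<rightarrow>\<^sub>t homotopic_imp_eq i)"
proof -
  let ?t = "Lam (PIE_closed_under_homotopies i) (Lam (diag_maps_PIE i)
    (Lam (Univ i) (Lam (Univ i) (Lam (Var 1 \<rightarrow>\<^sub>t Var 0) (Lam (Var 2 \<rightarrow>\<^sub>t Var 1)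
      (Lam (Homotopy (Var 3) (Var 2) (Var 1) (Var 0)) (homotopic_imp_eq_body i)))))))"
  have "checks [] ?t (Pi (PIE_closed_under_homotopies i) (Pi (diag_maps_PIE i) (homotopic_imp_eq i)))"
    \<comment> \<open>Turning the arrow out of the homotopy type into a \<open>Pi\<close> lets
      \<open>checks_Lam\<close> reach the last of the seven abstractions.\<close>
    unfolding homotopic_imp_eq_def Arr_def[of "Homotopy _ _ _ _"]
    by (intro checks_Lam[where i = "Suc i"] checks_PIE_closed_under_homotopies checks_diag_maps_PIE)
      (use checks_homotopic_imp_eq_body in \<open>simp_all add: Homotopy_def checks_simps\<close>)
  then show ?thesis
    by (auto simp: inhabited_def checks_def Arr_def ctx_emp)
qed

end
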